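(* Let $G$ be a Hausdorff topological group. Let $G_0$ be the connected component of $G$ containing $1$, and suppose $G / G_0$ is compact. Let $A$ be a separable prime C*-algebra with the ideal property. Suppose there exists a minimal (continuous) action $\alpha \colon G \to \mathrm{Aut}(A)$. Then $A$ is simple.
   Context: A C*-algebra $A$ has the ideal property if every closed two-sided ideal in $A$ is generated, as a closed ideal, by the projections it contains. An action of a topological group $G$ on $A$ is a homomorphism $\alpha \colon G \to \mathrm{Aut}(A)$ such that $g \mapsto \alpha_g(a)$ is norm continuous for all $a \in A$. The action is minimal if the only $\alpha$-invariant closed two-sided ideals of $A$ are $0$ and $A$. *)

theory Defs
  imports "HOL-Analysis.Analysis"
begin

text \<open>
  C*-algebras as a type class. No unit is required. The real scaling of the library classes is tied
  to the complex one; completeness and submultiplicativity of the norm come from \<^class>\<open>banach\<close>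
  and \<^class>\<open>real_normed_algebra\<close>.
\<close>

class cstar_algebra = banach + real_normed_algebra +
  fixes scaleC :: "complex \<Rightarrow> 'a \<Rightarrow> 'a"  (infixr \<open>*\<^sub>C\<close> 75)
    and star :: "'a \<Rightarrow> 'a"
  assumes scaleR_scaleC: "r *\<^sub>R x = complex_of_real r *\<^sub>C x"
    and scaleC_add_right: "c *\<^sub>C (x + y) = c *\<^sub>C x + c *\<^sub>C y"
    and scaleC_add_left: "(c + d) *\<^sub>C x = c *\<^sub>C x + d *\<^sub>C x"
    and scaleC_scaleC: "c *\<^sub>C d *\<^sub>C x = (c * d) *\<^sub>C x"
    and scaleC_one: "1 *\<^sub>C x = x"
    and mult_scaleC_left: "(c *\<^sub>C x) * y = c *\<^sub>C (x * y)"
    and mult_scaleC_right: "x * (c *\<^sub>C y) = c *\<^sub>C (x * y)"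
    and norm_scaleC: "norm (c *\<^sub>C x) = cmod c * norm x"
    and star_star: "star (star x) = x"
    and star_add: "star (x + y) = star x + star y"
    and star_scaleC: "star (c *\<^sub>C x) = cnj c *\<^sub>C star x"
    and star_mult: "star (x * y) = star y * star x"
    and norm_star_mult: "norm (star x * x) = (norm x)\<^sup>2"

instantiation complex :: cstar_algebra
begin

definition scaleC_complex :: "complex \<Rightarrow> complex \<Rightarrow> complex"
  where "scaleC_complex = (*)"

definition star_complex :: "complex \<Rightarrow> complex"
  where "star_complex = cnj"

instance
  by standard
    (auto simp: scaleC_complex_def star_complex_def scaleR_conv_of_real algebra_simps
      norm_mult power2_eq_square)

end

definition closed_ideal :: "'a::cstar_algebra set \<Rightarrow> bool"
  where "closed_ideal I \<longleftrightarrow>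
    closed I \<and> 0 \<in> I \<and> (\<forall>x\<in>I. \<forall>y\<in>I. x + y \<in> I) \<and> (\<forall>c. \<forall>x\<in>I. c *\<^sub>C x \<in> I) \<and>
    (\<forall>a. \<forall>x\<in>I. a * x \<in> I \<and> x * a \<in> I)"

definition is_projection :: "'a::cstar_algebra \<Rightarrow> bool"
  where "is_projection p \<longleftrightarrow> p * p = p \<and> star p = p"

definition ideal_property :: "'a::cstar_algebra itself \<Rightarrow> bool"
  where "ideal_property _ \<longleftrightarrow>
    (\<forall>I :: 'a set. closed_ideal I \<longrightarrow> closed_ideal hull {p \<in> I. is_projection p} = I)"

text \<open>By the usual convention, the zero algebra is neither prime nor simple.\<close>

definition prime_cstar :: "'a::cstar_algebra itself \<Rightarrow> bool"
  where "prime_cstar _ \<longleftrightarrow> (UNIV :: 'a set) \<noteq> {0} \<and>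
    (\<forall>I J :: 'a set. closed_ideal I \<longrightarrow> closed_ideal J \<longrightarrow>
      (\<forall>x\<in>I. \<forall>y\<in>J. x * y = 0) \<longrightarrow> I = {0} \<or> J = {0})"

definition simple_cstar :: "'a::cstar_algebra itself \<Rightarrow> bool"
  where "simple_cstar _ \<longleftrightarrow> (UNIV :: 'a set) \<noteq> {0} \<and>
    (\<forall>I :: 'a set. closed_ideal I \<longrightarrow> I = {0} \<or> I = UNIV)"

definition cstar_automorphism :: "('a::cstar_algebra \<Rightarrow> 'a) \<Rightarrow> bool"
  where "cstar_automorphism f \<longleftrightarrow> bij f \<and>
    (\<forall>x y. f (x + y) = f x + f y) \<and> (\<forall>c x. f (c *\<^sub>C x) = c *\<^sub>C f x) \<and>
    (\<forall>x y. f (x * y) = f x * f y) \<and> (\<forall>x. f (star x) = star (f x))"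

text \<open>
  Groups are written additively, as the library class \<^class>\<open>topological_group_add\<close> does; its
  addition is not assumed to be commutative. Thus \<open>0\<close> is the identity element.
\<close>

definition continuous_action :: "('g::topological_group_add \<Rightarrow> 'a::cstar_algebra \<Rightarrow> 'a) \<Rightarrow> bool"
  where "continuous_action \<alpha> \<longleftrightarrow>
    (\<forall>g. cstar_automorphism (\<alpha> g)) \<and> (\<forall>g h. \<alpha> (g + h) = \<alpha> g \<circ> \<alpha> h) \<and>
    (\<forall>a. continuous_on UNIV (\<lambda>g. \<alpha> g a))"

definition minimal_action :: "('g \<Rightarrow> 'a::cstar_algebra \<Rightarrow> 'a) \<Rightarrow> bool"
  where "minimal_action \<alpha> \<longleftrightarrow>
    (\<forall>I. closed_ideal I \<longrightarrow> (\<forall>g. \<alpha> g ` I \<subseteq> I) \<longrightarrow> I = {0} \<or> I = UNIV)"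

definition identity_component :: "'g::topological_group_add set"
  where "identity_component = connected_component_set UNIV 0"

definition left_coset :: "'g::topological_group_add set \<Rightarrow> 'g \<Rightarrow> 'g set"
  where "left_coset H g = (\<lambda>h. g + h) ` H"

definition coset_space :: "'g::topological_group_add set \<Rightarrow> 'g set topology"
  where "coset_space H =
    topology (\<lambda>U. U \<subseteq> range (left_coset H) \<and> open (left_coset H -` U))"

lemma openin_coset_space:
  "openin (coset_space H) U \<longleftrightarrow> U \<subseteq> range (left_coset H) \<and> open (left_coset H -` U)"
proof -
  have "istopology (\<lambda>U. U \<subseteq> range (left_coset H) \<and> open (left_coset H -` U))"
    unfolding istopology_def by (auto simp: vimage_Union)
  then show ?thesis
    unfolding coset_space_def by simp
qed

lemma quotient_map_coset_space:
  "quotient_map euclidean (coset_space H) (left_coset H)"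
proof -
  have "left_coset H -` range (left_coset H) = UNIV"
    by auto
  then have "openin (coset_space H) (range (left_coset H))"
    by (simp add: openin_coset_space)
  then have "topspace (coset_space H) = range (left_coset H)"
    by (metis openin_coset_space openin_subset openin_topspace subset_antisym)
  then show ?thesis
    by (auto simp: quotient_map_def openin_coset_space vimage_def)
qed

end

theory Submission
  imports Defs
begin

text \<open>
  Let \<open>J\<close> be a nonzero closed ideal; it contains a projection \<open>p \<noteq> 0\<close>. Minimality yields \<open>J = A\<close>
  as soon as the invariant closed ideal \<open>L\<close>, the intersection of all \<open>\<alpha>\<^sub>g\<close>-preimages of \<open>J\<close>, is
  nonzero. For a projection \<open>q\<close> the elements \<open>g\<close> with \<open>\<alpha>\<^sub>g(q) \<in> J\<close> form a set that is closed,
  by continuity of the action, and open, because a projection at distance less than one from an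
  element of \<open>J\<close> belongs to \<open>J\<close> (\<open>projection_near_closed_ideal\<close>). A clopen set is a union of
  cosets of the identity component, so compactness of the coset space applies to covers by such sets
  (\<open>finite_clopen_subcover\<close>). In particular, finitely many translates \<open>q\<close> of \<open>p\<close> suffice for every
  \<open>\<alpha>\<^sub>g\<close> to move at least one of them into \<open>J\<close>. Then \<open>\<alpha>\<^sub>g\<close> moves the closed ideal generated by
  that \<open>q\<close> into \<open>J\<close>, and hence also the intersection of these finitely many ideals. The intersection
  therefore lies in \<open>L\<close>, and it is nonzero because the algebra is prime.

  That preimages of closed ideals under automorphisms are again closed rests on the automatic
  continuity of automorphisms (\<open>automorphism_contractive\<close>). The proof given here avoids spectral
  theory: if \<open>h\<close> is self-adjoint with \<open>\<parallel>h\<parallel> < 1\<close>, then \<open>h + \<i> sqrt (1 - h\<^sup>2)\<close> is unitary, an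
  algebraic relation that an automorphism preserves, and the C*-identity bounds the real part of a
  unitary by one.
\<close>

section \<open>Automatic continuity of automorphisms\<close>

lemma scaleC_0_right [simp]: "c *\<^sub>C (0::'a::cstar_algebra) = 0"
  using scaleC_add_right[of c 0 0] by simp

lemma scaleC_minus_one: "(-1) *\<^sub>C x = - (x::'a::cstar_algebra)"
  using scaleR_scaleC[of "-1" x] by simp

lemma star_zero [simp]: "star (0::'a::cstar_algebra) = 0"
  using star_add[of 0 0] by simp

lemma star_minus: "star (- x) = - star (x::'a::cstar_algebra)"
  using star_add[of x "- x"] by (metis add.right_inverse minus_unique star_zero)

lemma star_diff: "star (x - y) = star x - star (y::'a::cstar_algebra)"
  using star_add[of x "- y"] by (simp add: star_minus)

lemma star_scaleR: "star (r *\<^sub>R x) = r *\<^sub>R star (x::'a::cstar_algebra)"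
  by (simp add: scaleR_scaleC star_scaleC)

lemma norm_star [simp]: "norm (star x) = norm (x::'a::cstar_algebra)"
proof -
  have le: "norm y \<le> norm (star y)" for y :: 'a
  proof (cases "y = 0")
    case False
    have "norm y * norm y \<le> norm (star y) * norm y"
      using norm_mult_ineq[of "star y" y] by (simp add: norm_star_mult power2_eq_square)
    with False show ?thesis by simp
  qed simp
  from le[of x] le[of "star x"] show ?thesis by (simp add: star_star)
qed

lemma continuous_on_star: "continuous_on S (star :: 'a::cstar_algebra \<Rightarrow> 'a)"
proof (rule continuous_onI)
  fix x :: 'a and e :: real
  assume "x \<in> S" "0 < e"
  then show "\<exists>d>0. \<forall>x'\<in>S. dist x' x < d \<longrightarrow> dist (star x') (star x) \<le> e"
    by (intro exI[of _ e]) (auto simp: dist_norm simp flip: star_diff)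
qed

text \<open>
  The element \<open>c\<close> is \<open>sqrt (1 - h\<^sup>2) - 1\<close>, which lies in the algebra even when the unit does not.
  Its defining equation reads \<open>c = - (h\<^sup>2 + c\<^sup>2) / 2\<close>, and the right hand side is a contraction, with
  factor \<open>\<parallel>h\<parallel>\<close>, of the closed ball of radius \<open>\<parallel>h\<parallel> < 1\<close>.
\<close>

lemma exists_sqrt_one_minus_square:
  fixes h :: "'a::cstar_algebra"
  assumes h: "star h = h" and less: "norm h < 1"
  obtains c where "star c = c" "h * c = c * h" "c + c + c * c + h * h = 0"
proof -
  \<comment> \<open>The side conditions on \<open>c\<close> are closed and preserved by \<open>f\<close>, so the fixed point satisfies them.\<close>
  define S where "S = {c. norm c \<le> norm h \<and> star c = c \<and> h * c = c * h}"
  define f where "f c = - ((1/2) *\<^sub>R (h * h + c * c))" for c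
  have "S = {c. norm c \<le> norm h} \<inter> {c. star c = c} \<inter> {c. h * c = c * h}"
    by (auto simp: S_def)
  moreover have "closed {c :: 'a. star c = c}"
    by (intro closed_Collect_eq continuous_on_star continuous_on_id)
  ultimately have "closed S"
    by (auto intro!: closed_Int closed_Collect_le closed_Collect_eq continuous_intros)
  then have "complete S"
    by (simp add: complete_eq_closed)
  moreover have "S \<noteq> {}"
  proof -
    have "0 \<in> S" by (simp add: S_def)
    then show ?thesis by blast
  qed
  moreover have "f ` S \<subseteq> S"
  proof clarify
    fix c assume "c \<in> S"
    then have c: "norm c \<le> norm h" "star c = c" "h * c = c * h"
      by (auto simp: S_def)
    have "norm (h * h + c * c) \<le> norm h * norm h + norm c * norm c"
      by (intro order_trans[OF norm_triangle_ineq] add_mono norm_mult_ineq)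
    also have "\<dots> \<le> norm h * 1 + norm h * 1"
      using c(1) less by (intro add_mono mult_mono) auto
    finally have "norm (f c) \<le> norm h"
      by (simp add: f_def)
    moreover have "star (f c) = f c"
      by (simp add: f_def star_minus star_scaleR star_add star_mult c(2) h)
    moreover have "h * (c * c) = c * c * h"
      by (metis c(3) mult.assoc)
    then have "h * f c = f c * h"
      by (simp add: f_def algebra_simps)
    ultimately show "f c \<in> S"
      by (simp add: S_def)
  qed
  moreover have "dist (f c) (f d) \<le> norm h * dist c d" if "c \<in> S" "d \<in> S" for c d
  proof -
    have cd: "norm c \<le> norm h" "norm d \<le> norm h"
      using that by (simp_all add: S_def)
    have "c * c - d * d = c * (c - d) + (c - d) * d"
      by (simp add: algebra_simps)
    then have "norm (c * c - d * d) \<le> norm c * norm (c - d) + norm (c - d) * norm d"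
      by (simp only:) (intro order_trans[OF norm_triangle_ineq] add_mono norm_mult_ineq)
    also have "\<dots> \<le> norm h * norm (c - d) + norm (c - d) * norm h"
      by (intro add_mono mult_mono cd order_refl norm_ge_zero)
    finally have "norm (c * c - d * d) \<le> 2 * (norm h * norm (c - d))"
      by simp
    moreover have "f c - f d = - ((1/2) *\<^sub>R (c * c - d * d))"
      by (simp add: f_def algebra_simps)
    ultimately show ?thesis
      by (simp add: dist_norm)
  qed
  ultimately have "\<exists>!c\<in>S. f c = c"
    by (intro Banach_fix[OF _ _ norm_ge_zero less]) blast+
  then obtain c where "c \<in> S" "f c = c"
    by blast
  then have "c + c + c * c + h * h = 2 *\<^sub>R f c + c * c + h * h"
    by (simp add: scaleR_2)
  also have "\<dots> = 0"
    by (simp add: f_def)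
  finally show thesis
    using \<open>c \<in> S\<close> by (intro that) (auto simp: S_def)
qed

text \<open>
  With \<open>w = 1 + c\<close>, the hypotheses say that \<open>k\<close> and \<open>w\<close> are commuting self-adjoint elements with
  \<open>k\<^sup>2 + w\<^sup>2 = 1\<close>, so \<open>k \<plusminus> \<i>w\<close> are unitary and \<open>k\<close> is their mean. The unitaries need not lie in the
  algebra, but left multiplication by them acts on it isometrically, by the C*-identity.
\<close>

lemma norm_le_1_if_sqrt:
  fixes k c :: "'a::cstar_algebra"
  assumes k: "star k = k" and c: "star c = c" and comm: "k * c = c * k"
    and eq: "c + c + c * c + k * k = 0"
  shows "norm k \<le> 1"
proof -
  \<comment> \<open>This is \<open>(k + z w) k\<close>, for \<open>z = \<plusminus>\<i>\<close> the unitary applied to \<open>k\<close>, written without the unit.\<close>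
  define u where "u z = k * k + z *\<^sub>C (k + c * k)" for z
  have norm_u: "norm (u z) = norm k" if z: "z = \<i> \<or> z = -\<i>" for z
  proof -
    define w where "w = k + c * k"
    have star_w: "star w = w"
      by (simp add: w_def star_add star_mult k c comm)
    have w_alt: "w = k + k * c"
      by (simp add: w_def comm)
    have kw: "k * w = w * k"
      by (simp add: w_def algebra_simps comm[symmetric])
    have zz: "cnj z * z = 1" and cz: "cnj z = - z"
      using z by auto
    have neg: "(- z) *\<^sub>C x = - (z *\<^sub>C x)" for x :: 'a
      using scaleC_scaleC[of "-1" z x] by (simp add: scaleC_minus_one)
    have "star (u z) * u z
        = k * k * (k * k) + z *\<^sub>C (k * k * w) + cnj z *\<^sub>C (w * (k * k)) + (cnj z * z) *\<^sub>C (w * w)"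
      by (simp add: u_def star_add star_mult star_scaleC k star_w distrib_left distrib_right
          mult_scaleC_left mult_scaleC_right scaleC_scaleC scaleC_add_right
          mult.commute[of z] flip: w_def)
    also have "w * (k * k) = k * k * w"
      by (metis kw mult.assoc)
    also have "(cnj z * z) *\<^sub>C (w * w) = w * w"
      by (simp add: zz scaleC_one)
    also have "k * k * (k * k) + z *\<^sub>C (k * k * w) + cnj z *\<^sub>C (k * k * w) + w * w
        = k * k * (k * k) + w * w"
      by (simp add: cz neg)
    also have "w * w = k * (k + c * k + c * k + c * c * k)"
      by (subst (1) w_alt) (simp add: w_def algebra_simps)
    also have "k * k * (k * k) + k * (k + c * k + c * k + c * c * k)
        = k * k + k * ((c + c + c * c + k * k) * k)"
      by (simp add: algebra_simps)
    also have "\<dots> = star k * k"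
      by (simp add: eq k)
    finally have "(norm (u z))\<^sup>2 = (norm k)\<^sup>2"
      by (metis norm_star_mult)
    then show ?thesis
      by simp
  qed
  have "u \<i> + u (-\<i>) = k * k + k * k + (\<i> + - \<i>) *\<^sub>C (k + c * k)"
    unfolding scaleC_add_left by (simp add: u_def)
  also have "\<dots> = 2 *\<^sub>R (k * k)"
    using scaleR_scaleC[of 0 "k + c * k"] by (simp add: scaleR_2)
  finally have "norm (2 *\<^sub>R (k * k)) \<le> norm (u \<i>) + norm (u (-\<i>))"
    by (metis norm_triangle_ineq)
  then have "norm (star k * k) \<le> norm k"
    by (simp add: norm_u k)
  then have "norm k * norm k \<le> norm k * 1"
    by (simp add: norm_star_mult power2_eq_square)
  then show ?thesis
    by (metis mult_le_cancel_left_pos norm_ge_zero order_le_less zero_le_one)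
qed

context
  fixes f :: "'a::cstar_algebra \<Rightarrow> 'a"
  assumes f: "cstar_automorphism f"
begin

lemma automorphism_add: "f (x + y) = f x + f y"
  and automorphism_scaleC: "f (c *\<^sub>C x) = c *\<^sub>C f x"
  and automorphism_mult: "f (x * y) = f x * f y"
  and automorphism_star: "f (star x) = star (f x)"
  and automorphism_bij: "bij f"
  using f by (auto simp: cstar_automorphism_def)

lemma automorphism_scaleR: "f (r *\<^sub>R x) = r *\<^sub>R f x"
  by (simp add: scaleR_scaleC automorphism_scaleC)

lemma automorphism_zero: "f 0 = 0"
  using automorphism_add[of 0 0] by simp

text \<open>
  An automorphism transports the square root of \<open>1 - h\<^sup>2\<close>, so it maps the self-adjoint elements of
  the open unit ball into the closed unit ball; scaling and the C*-identity do the rest.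
\<close>

lemma automorphism_contractive: "norm (f x) \<le> norm x"
proof -
  have unit: "norm (f h) \<le> 1" if h: "star h = h" "norm h < 1" for h
  proof -
    obtain c where c: "star c = c" "h * c = c * h" "c + c + c * c + h * h = 0"
      using exists_sqrt_one_minus_square[OF h] .
    have "f c + f c + f c * f c + f h * f h = 0"
      by (metis c(3) automorphism_add automorphism_mult automorphism_zero)
    then show ?thesis
      using norm_le_1_if_sqrt[of "f h" "f c"]
      by (metis c(1,2) h(1) automorphism_mult automorphism_star)
  qed
  have self_adjoint: "norm (f h) \<le> norm h" if "star h = h" for h
  proof (rule field_le_epsilon)
    fix e :: real assume "0 < e"
    define r where "r = norm h + e"
    have "r > 0"
      using \<open>0 < e\<close> by (simp add: r_def add_nonneg_pos)
    have "norm (inverse r *\<^sub>R h) < 1"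
      using \<open>r > 0\<close> \<open>0 < e\<close> by (simp add: r_def field_simps)
    then have "norm (f (inverse r *\<^sub>R h)) \<le> 1"
      using that by (intro unit) (simp_all add: star_scaleR)
    then show "norm (f h) \<le> norm h + e"
      using \<open>r > 0\<close> by (simp add: automorphism_scaleR r_def field_simps)
  qed
  have "(norm (f x))\<^sup>2 = norm (f (star x * x))"
    by (simp add: automorphism_mult automorphism_star norm_star_mult)
  also have "\<dots> \<le> norm (star x * x)"
    by (rule self_adjoint) (simp add: star_mult star_star)
  finally show ?thesis
    by (simp add: norm_star_mult)
qed

lemma automorphism_continuous: "continuous_on S f"
proof -
  have "bounded_linear f"
    using automorphism_contractive
    by (intro bounded_linear_intro[where K = 1]) (auto simp: automorphism_add automorphism_scaleR)
  then show ?thesis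
    by (simp add: linear_continuous_on)
qed

lemma automorphism_projection: "is_projection p \<Longrightarrow> is_projection (f p)"
  by (simp add: is_projection_def flip: automorphism_mult automorphism_star)

end

section \<open>Closed ideals and projections\<close>

lemma closed_ideal_diff:
  assumes "closed_ideal I" "x \<in> I" "y \<in> I"
  shows "x - y \<in> I"
proof -
  have "x + (-1) *\<^sub>C y \<in> I"
    using assms by (simp add: closed_ideal_def)
  then show ?thesis
    by (simp add: scaleC_minus_one)
qed

lemma closed_ideal_zero: "closed_ideal {0}"
  by (simp add: closed_ideal_def)

lemma closed_ideal_Inter:
  assumes "\<And>I. I \<in> \<I> \<Longrightarrow> closed_ideal I"
  shows "closed_ideal (\<Inter>\<I>)"
  using assms unfolding closed_ideal_def by (auto intro!: closed_Inter)

lemma closed_ideal_hull: "closed_ideal (closed_ideal hull S)"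
  by (rule hull_in) (auto intro: closed_ideal_Inter)

lemma closed_ideal_vimage:
  assumes f: "cstar_automorphism f" and I: "closed_ideal I"
  shows "closed_ideal (f -` I)"
proof -
  have "closed (f -` I)"
    using I automorphism_continuous[OF f, of UNIV]
    by (simp add: closed_ideal_def continuous_on_closed_vimage)
  then show ?thesis
    using I by (simp add: closed_ideal_def automorphism_add[OF f] automorphism_zero[OF f]
        automorphism_scaleC[OF f] automorphism_mult[OF f])
qed

text \<open>
  The image of \<open>p\<close> in the quotient by \<open>I\<close> is a projection of norm less than one, hence zero. Without
  forming the quotient: \<open>p = p\<^sup>n\<close> is congruent to \<open>(p - x)\<^sup>n\<close> modulo \<open>I\<close>, and these powers tend to zero.
\<close>

lemma projection_near_closed_ideal:
  assumes I: "closed_ideal I" and p: "is_projection p" and x: "x \<in> I" "dist x p < 1"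
  shows "p \<in> I"
proof -
  define r where "r = norm (p - x)"
  have approx: "\<exists>y\<in>I. norm (p - y) \<le> r ^ Suc n" for n
  proof (induction n)
    case 0
    show ?case
      using x(1) by (auto simp: r_def)
  next
    case (Suc n)
    then obtain y where y: "y \<in> I" "norm (p - y) \<le> r ^ Suc n"
      by blast
    define z where "z = y * p + (p * x - y * x)"
    have "z \<in> I"
      using closed_ideal_diff[OF I] I x(1) y(1) by (simp add: z_def closed_ideal_def)
    moreover have "p - z = (p - y) * (p - x)"
      using p by (simp add: z_def is_projection_def algebra_simps)
    then have "norm (p - z) \<le> norm (p - y) * r"
      by (simp add: r_def norm_mult_ineq)
    then have "norm (p - z) \<le> r ^ Suc (Suc n)"
      using mult_right_mono[OF y(2), of r] by (simp add: r_def mult.commute)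
    ultimately show ?case
      by blast
  qed
  have "\<exists>y\<in>I. dist y p < e" if "0 < e" for e
  proof -
    have "r < 1"
      using x(2) by (simp add: r_def dist_norm norm_minus_commute)
    then obtain n where "r ^ n < e"
      using real_arch_pow_inv[OF \<open>0 < e\<close>] by blast
    moreover have "r ^ Suc n \<le> r ^ n"
      using \<open>r < 1\<close> by (intro power_decreasing) (auto simp: r_def)
    ultimately show ?thesis
      using approx[of n] by (metis dist_commute dist_norm le_less_trans)
  qed
  then have "p \<in> closure I"
    by (simp add: closure_approachable)
  then show ?thesis
    using I by (simp add: closed_ideal_def)
qed

lemma ideal_property_nonzero_projection:
  fixes J :: "'a::cstar_algebra set"
  assumes "ideal_property TYPE('a)" "closed_ideal J" "J \<noteq> {0}"
  obtains p where "p \<in> J" "is_projection p" "p \<noteq> 0"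
proof -
  have "\<exists>p\<in>J. is_projection p \<and> p \<noteq> 0"
  proof (rule ccontr)
    assume "\<not> ?thesis"
    then have "closed_ideal hull {p \<in> J. is_projection p} \<subseteq> {0}"
      by (intro hull_minimal closed_ideal_zero) auto
    then have "J \<subseteq> {0}"
      using assms by (simp add: ideal_property_def)
    with assms show False
      by (auto simp: closed_ideal_def)
  qed
  then show thesis
    using that by blast
qed

text \<open>
  Primeness makes the product of two nonzero ideals nonzero, and the product lies in the intersection.
\<close>

lemma prime_cstar_finite_Inter:
  fixes \<I> :: "'a::cstar_algebra set set"
  assumes prime: "prime_cstar TYPE('a)"
    and "finite \<I>" and "\<And>I. I \<in> \<I> \<Longrightarrow> closed_ideal I \<and> I \<noteq> {0}"
  shows "\<Inter>\<I> \<noteq> {0}"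
  using assms(2,3)
proof (induction \<I>)
  case empty
  show ?case
    using prime by (simp add: prime_cstar_def)
next
  case (insert I \<I>)
  have I: "closed_ideal I" and K: "closed_ideal (\<Inter>\<I>)"
    using insert.prems closed_ideal_Inter[of \<I>] by auto
  moreover have "I \<noteq> {0}" "\<Inter>\<I> \<noteq> {0}"
    using insert by auto
  ultimately obtain x y where xy: "x \<in> I" "y \<in> \<Inter>\<I>" "x * y \<noteq> 0"
    using prime unfolding prime_cstar_def by blast
  then have "x * y \<in> I" "x * y \<in> \<Inter>\<I>"
    using I K unfolding closed_ideal_def by blast+
  then show ?case
    using xy(3) by auto
qed

section \<open>Actions and cosets of the identity component\<close>

lemma continuous_action_zero:
  assumes "continuous_action \<alpha>"
  shows "\<alpha> 0 x = x"
proof -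
  have "\<alpha> 0 (\<alpha> 0 x) = \<alpha> (0 + 0) x"
    using assms by (simp only: continuous_action_def comp_def)
  moreover have "inj (\<alpha> 0)"
    using assms by (simp add: continuous_action_def automorphism_bij bij_is_inj)
  ultimately show ?thesis
    by (simp add: inj_eq)
qed

text \<open>
  Every \<open>\<alpha> g p\<close> is a projection, so it lies in \<open>J\<close> as soon as it lies in the open neighbourhood of
  \<open>J\<close> of radius one. The set is thus the preimage of a closed set and of an open one.
\<close>

lemma clopen_transporter:
  fixes \<alpha> :: "'g::topological_group_add \<Rightarrow> 'a::cstar_algebra \<Rightarrow> 'a"
  assumes \<alpha>: "continuous_action \<alpha>" and J: "closed_ideal J" and p: "is_projection p"
  shows "open {g. \<alpha> g p \<in> J}" "closed {g. \<alpha> g p \<in> J}"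
proof -
  have cont: "continuous_on UNIV (\<lambda>g. \<alpha> g p)"
    using \<alpha> by (simp add: continuous_action_def)
  then have "closed ((\<lambda>g. \<alpha> g p) -` J)"
    using J by (simp add: closed_ideal_def continuous_on_closed_vimage)
  then show "closed {g. \<alpha> g p \<in> J}"
    by (simp add: vimage_def)
  have "is_projection (\<alpha> g p)" for g
    using \<alpha> p by (simp add: continuous_action_def automorphism_projection)
  then have "\<alpha> g p \<in> J" if "\<alpha> g p \<in> (\<Union>x\<in>J. ball x 1)" for g
    using projection_near_closed_ideal[OF J] that by auto
  moreover have "J \<subseteq> (\<Union>x\<in>J. ball x 1)"
    by auto
  ultimately have "{g. \<alpha> g p \<in> J} = (\<lambda>g. \<alpha> g p) -` (\<Union>x\<in>J. ball x 1)"
    by blast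
  moreover have "open ((\<lambda>g. \<alpha> g p) -` (\<Union>x\<in>J. ball x 1))"
    by (rule open_vimage[OF _ cont]) (rule open_UN, simp)
  ultimately show "open {g. \<alpha> g p \<in> J}"
    by (simp only:)
qed

lemma mem_left_coset_identity_component: "g \<in> left_coset identity_component g"
  unfolding left_coset_def identity_component_def by (intro image_eqI[of _ _ 0]) auto

lemma clopen_left_coset_subset:
  fixes W :: "'g::topological_group_add set"
  assumes "open W" "closed W" "g \<in> W"
  shows "left_coset identity_component g \<subseteq> W"
proof -
  have "connected (left_coset identity_component g)"
    unfolding left_coset_def identity_component_def
    by (intro connected_continuous_image continuous_intros connected_connected_component)
  then have "W \<inter> left_coset identity_component g = {} \<or> - W \<inter> left_coset identity_component g = {}"
    by (rule connectedD) (use assms in \<open>auto simp: open_Compl\<close>)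
  then show ?thesis
    using assms(3) mem_left_coset_identity_component by blast
qed

text \<open>
  A clopen set is a union of cosets of the identity component, so it is the preimage of an open set
  of the coset space.
\<close>

lemma finite_clopen_subcover:
  fixes \<W> :: "'g::topological_group_add set set"
  assumes compact: "compact_space (coset_space (identity_component :: 'g set))"
    and clopen: "\<And>W. W \<in> \<W> \<Longrightarrow> open W \<and> closed W"
    and cover: "\<Union>\<W> = UNIV"
  obtains \<F> where "finite \<F>" "\<F> \<subseteq> \<W>" "\<Union>\<F> = UNIV"
proof -
  define \<pi> :: "'g \<Rightarrow> 'g set" where "\<pi> = left_coset identity_component"
  have saturated: "\<pi> -` \<pi> ` W = W" if "W \<in> \<W>" for W
  proof -
    have "h \<in> W" if "g \<in> W" "\<pi> h = \<pi> g" for g h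
      using clopen_left_coset_subset[of W g] clopen[OF \<open>W \<in> \<W>\<close>] that
        mem_left_coset_identity_component[of h] by (auto simp: \<pi>_def)
    then show ?thesis
      by auto
  qed
  have "openin (coset_space identity_component) (\<pi> ` W)" if "W \<in> \<W>" for W
    using clopen[OF that] saturated[OF that] by (auto simp: openin_coset_space \<pi>_def)
  then have opens: "\<forall>U \<in> (`) \<pi> ` \<W>. openin (coset_space identity_component) U"
    by blast
  have topspace: "topspace (coset_space identity_component) = range \<pi>"
    using quotient_imp_surjective_map[OF quotient_map_coset_space[of identity_component], symmetric]
    by (simp only: \<pi>_def topspace_euclidean)
  then have "topspace (coset_space identity_component) \<subseteq> \<Union>((`) \<pi> ` \<W>)"
    by (simp add: cover flip: image_Union)
  with opens obtain \<G> where \<G>: "finite \<G>" "\<G> \<subseteq> (`) \<pi> ` \<W>"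
    "topspace (coset_space identity_component) \<subseteq> \<Union>\<G>"
    using compact[unfolded compact_space_alt, rule_format, of "(`) \<pi> ` \<W>"] by blast
  then obtain \<F> where \<F>: "finite \<F>" "\<F> \<subseteq> \<W>" "\<G> = (`) \<pi> ` \<F>"
    by (meson finite_subset_image)
  have "g \<in> \<Union>\<F>" for g
  proof -
    have "\<pi> g \<in> \<Union>\<G>"
      using \<G>(3) unfolding topspace by (rule subsetD) (rule rangeI)
    then obtain W where W: "W \<in> \<F>" "g \<in> \<pi> -` \<pi> ` W"
      unfolding \<F>(3) by auto
    then have "g \<in> W"
      using saturated \<F>(2) by (metis subsetD)
    with W(1) show ?thesis
      by (rule UnionI)
  qed
  then show thesis
    using that \<F>(1,2) by blast
qed

section \<open>Simplicity\<close>

theorem corollary4p5: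
  assumes "compact_space (coset_space (identity_component :: 'g::{topological_group_add, t2_space} set))"
    and "separable_space (euclidean :: 'a::cstar_algebra topology)"
    and "prime_cstar TYPE('a)"
    and "ideal_property TYPE('a)"
    and "\<exists>\<alpha> :: 'g \<Rightarrow> 'a \<Rightarrow> 'a. continuous_action \<alpha> \<and> minimal_action \<alpha>"
  shows "simple_cstar TYPE('a)"
proof -
  obtain \<alpha> :: "'g \<Rightarrow> 'a \<Rightarrow> 'a" where \<alpha>: "continuous_action \<alpha>" and minimal: "minimal_action \<alpha>"
    using assms(5) by blast
  have auto: "cstar_automorphism (\<alpha> g)" and plus: "\<alpha> (g + h) x = \<alpha> g (\<alpha> h x)" for g h x
    using \<alpha> by (simp_all add: continuous_action_def)
  have "J = UNIV" if J: "closed_ideal J" "J \<noteq> {0}" for J :: "'a set"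
  proof -
    obtain p where p: "p \<in> J" "is_projection p" "p \<noteq> 0"
      using ideal_property_nonzero_projection[OF assms(4) J] .
    define W where "W k = {g. \<alpha> g (\<alpha> (- k) p) \<in> J}" for k
    \<comment> \<open>The translate \<open>\<alpha> (- k) p\<close> is chosen because \<open>\<alpha> k\<close> moves it back to \<open>p\<close>.\<close>
    have "k \<in> W k" for k
      by (simp add: W_def p(1) continuous_action_zero[OF \<alpha>] flip: plus)
    then have "\<Union>(range W) = UNIV"
      by blast
    moreover have "is_projection (\<alpha> k p)" for k
      by (rule automorphism_projection[OF auto p(2)])
    then have "open V \<and> closed V" if "V \<in> range W" for V
      using that clopen_transporter[OF \<alpha> J(1)] by (auto simp: W_def)
    ultimately obtain \<F> where "finite \<F>" "\<F> \<subseteq> range W" "\<Union>\<F> = UNIV"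
      using finite_clopen_subcover[OF assms(1)] by metis
    then obtain K where K: "finite K" "(\<Union>k\<in>K. W k) = UNIV"
      by (metis finite_subset_image)
    define I where "I k = closed_ideal hull {\<alpha> (- k) p}" for k
    have "\<alpha> (- k) p \<in> I k" for k
      by (simp add: I_def hull_inc)
    moreover have "\<alpha> g p \<noteq> 0" for g
      using automorphism_bij[OF auto] automorphism_zero[OF auto] p(3)
      by (metis bij_is_inj injD)
    ultimately have "I k \<noteq> {0}" for k
      by blast
    then have nonzero: "\<Inter>(I ` K) \<noteq> {0}"
      using K(1) by (intro prime_cstar_finite_Inter[OF assms(3)]) (auto simp: I_def closed_ideal_hull)
    define L where "L = (\<Inter>g. \<alpha> g -` J)"
    have L: "closed_ideal L"
      unfolding L_def by (rule closed_ideal_Inter) (auto intro: closed_ideal_vimage[OF auto J(1)])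
    have "\<Inter>(I ` K) \<subseteq> \<alpha> g -` J" for g
    proof -
      obtain k where "k \<in> K" "g \<in> W k"
        using K(2) by blast
      then have "I k \<subseteq> \<alpha> g -` J"
        unfolding I_def by (intro hull_minimal closed_ideal_vimage[OF auto J(1)]) (simp add: W_def)
      with \<open>k \<in> K\<close> show ?thesis
        by blast
    qed
    then have "\<Inter>(I ` K) \<subseteq> L"
      by (auto simp: L_def)
    moreover have "0 \<in> \<Inter>(I ` K)"
      using closed_ideal_hull by (auto simp: I_def closed_ideal_def)
    ultimately have "L \<noteq> {0}"
      using nonzero by blast
    moreover have "\<alpha> g ` L \<subseteq> L" for g
      by (auto simp: L_def simp flip: plus)
    ultimately have "L = UNIV"
      using minimal L by (auto simp: minimal_action_def)
    then have "\<alpha> 0 x \<in> J" for x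
      unfolding L_def by blast
    then show ?thesis
      by (auto simp: continuous_action_zero[OF \<alpha>])
  qed
  then show ?thesis
    using assms(3) by (auto simp: simple_cstar_def prime_cstar_def)
qed

end
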